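(* Let $\mathbf{E}$ be a class of morphisms in a category $\mathscr{C}$, and let $f$ be a morphism in $\mathscr{C}$ that has the canonical $\mathbf{E}$-predecomposition. Then: (i) the minimum $\mathbf{E}$-decomposition number $\delta_{\mathbf{E}}(f)$ is defined if and only if the canonical $\mathbf{E}$-decomposition number $\sigma_{\mathbf{E}}(f)$ is defined; (ii) $\delta_{\mathbf{E}}(f)\le\sigma_{\mathbf{E}}(f)\le\delta_{\mathbf{E}}(f)+1$ whenever they are defined; (iii) if $\delta_{\mathbf{E}}(f)$ is (defined and) a successor ordinal, then $\delta_{\mathbf{E}}(f)=\sigma_{\mathbf{E}}(f)$.
   Context: Sizes: fix universes $\mathcal{U}_1\in\mathcal{U}_2\in\mathcal{U}_3$; small means in $\mathcal{U}_1$, large means in $\mathcal{U}_2$; $\upsilon$ is the smallest ordinal not in $\mathcal{U}_1$. Categories are large by default; classes have no size restriction. Orthogonality: for $p\colon X\to Y$, $e\colon A'\to A$, $m\colon A\to B$, write $p\perp^{e} m$ if for all $u\colon X\to A'$, $v\colon Y\to B$ with $m e u=v p$ there is a unique $h\colon Y\to A$ with $hp=eu$ and $mh=v$. Write $p\perp m$ for $p\perp^{\mathrm{id}_A}m$. For a class $\mathbf{E}$, $\mathbf{E}\perp^{e}m$ (resp. $\mathbf{E}\perp m$) means $p\perp^e m$ (resp. $p\perp m$) for all $p\in\mathbf{E}$. Decompositions: an ordinal $\alpha$ is regarded as the poset $\{\beta\mid\beta<\alpha\}$. For a functor $A_\bullet\colon\alpha\to\mathscr{C}$, $A_{\beta,\beta'}\colon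 A_\beta\to A_{\beta'}$ is the image of the unique morphism $\beta\le\beta'$. A transfinite $\alpha$-sequence is a functor $A_\bullet\colon\alpha\to\mathscr{C}$ with $A_\gamma\cong\mathrm{colim}_{\beta<\gamma}A_\beta$ (canonically) for every non-zero limit ordinal $\gamma<\alpha$; it is an $\mathbf{E}$-transfinite sequence if $A_{\beta,\beta+1}\in\mathbf{E}$ whenever $\beta+1<\alpha$. For $0<\gamma\le\upsilon$, an $(\mathbf{E},\gamma)$-predecomposition $(A_\bullet,f_\bullet,X)$ is an $\mathbf{E}$-transfinite $\gamma$-sequence $A_\bullet$ with a cocone $(f_\alpha\colon A_\alpha\to X)_{\alpha<\gamma}$ over it; it is a predecomposition of the morphism $f_0$. It stabilizes at $\alpha<\gamma$ if $\mathbf{E}\perp f_\beta$ for all $\beta$ with $\alpha\le\beta<\gamma$. It is a decomposition if it stabilizes at some $\alpha<\gamma$, and the least such $\alpha$ is its length $|f_\bullet|$. When $\gamma=\upsilon$ one says $\mathbf{E}$-predecomposition and $\mathbf{E}$-decomposition. An $(\mathbf{E},\gamma)$-predecomposition is canonical if $\mathbf{E}\perp^{A_{\alpha,\alpha+1}}f_{\alpha+1}$ for every $\alpha$ with $\alpha+1<\gamma$; the canonical predecomposition of a morphism is unique up to isomorphism if it exists. $\delta_{\mathbf{E}}(f)$ is the smallest ordinal $\alpha$ such that $f$ has an $\mathbf{E}$-decomposition of length $\alpha$ (undefined if $f$ has no $\mathbf{E}$-decomposition). $\sigma_{\mathbf{E}}(f)$ is the length of the canonical $\mathbf{E}$-predecomposition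 of $f$ if that exists and stabilizes (otherwise undefined). *)

theory Defs
  imports Main
begin

unbundle cardinal_syntax

section \<open>Small ordinals\<close>

text \<open>
  The ordinal \<open>\<upsilon>\<close> of the universe of small sets is rendered as a well-ordered type \<open>'i\<close>, whose
  elements are the ordinals \<open>\<alpha> < \<upsilon>\<close>, i.e. the small ordinals.  HOL has no set-theoretic universes,
  so the fact that \<open>\<upsilon>\<close> is the least ordinal outside a universe is expressed by the usual
  description of such ordinals: infinite regular strong limit cardinals.  The case \<open>\<upsilon> = \<omega>\<close>, which
  belongs to the universe of hereditarily finite sets, is not excluded.
\<close>

definition universe_ordinal :: "'i::wellorder itself \<Rightarrow> bool" where
  "universe_ordinal _ \<longleftrightarrow>
    (let r = {(\<alpha>, \<beta>). \<alpha> \<le> (\<beta>::'i)} in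
      Card_order r \<and> infinite (UNIV :: 'i set) \<and> regularCard r \<and>
      (\<forall>\<alpha>::'i. |Pow {..<\<alpha>}| <o r))"

definition ord_zero :: "'i::wellorder" where
  "ord_zero = (LEAST \<alpha>. True)"

text \<open>If there were a greatest element then its \<open>ord_suc\<close> would be unspecified; in a
  \<open>universe_ordinal\<close> type there is none.\<close>

definition ord_suc :: "'i::wellorder \<Rightarrow> 'i" where
  "ord_suc \<alpha> = (LEAST \<beta>. \<alpha> < \<beta>)"

definition is_successor :: "'i::wellorder \<Rightarrow> bool" where
  "is_successor \<alpha> \<longleftrightarrow> (\<exists>\<beta>. \<alpha> = ord_suc \<beta>)"

definition nonzero_limit :: "'i::wellorder \<Rightarrow> bool" where
  "nonzero_limit \<alpha> \<longleftrightarrow> \<alpha> \<noteq> ord_zero \<and> \<not> is_successor \<alpha>"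


section \<open>Categories and orthogonality\<close>

record ('o, 'm) cat =
  Obj :: "'o set"
  Arr :: "'m set"
  Dom :: "'m \<Rightarrow> 'o"
  Cod :: "'m \<Rightarrow> 'o"
  Id :: "'o \<Rightarrow> 'm"
  Comp :: "'m \<Rightarrow> 'm \<Rightarrow> 'm" (infixl "\<cdot>\<index>" 70)

definition hom :: "('o, 'm, 'x) cat_scheme \<Rightarrow> 'o \<Rightarrow> 'o \<Rightarrow> 'm set" where
  "hom C a b = {f \<in> Arr C. Dom C f = a \<and> Cod C f = b}"

locale category =
  fixes C :: "('o, 'm, 'x) cat_scheme" (structure)
  assumes Dom_in_Obj: "f \<in> Arr C \<Longrightarrow> Dom C f \<in> Obj C"
    and Cod_in_Obj: "f \<in> Arr C \<Longrightarrow> Cod C f \<in> Obj C"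
    and Id_in_hom: "a \<in> Obj C \<Longrightarrow> Id C a \<in> hom C a a"
    and Comp_in_hom: "\<lbrakk>f \<in> hom C a b; g \<in> hom C b c\<rbrakk> \<Longrightarrow> g \<cdot> f \<in> hom C a c"
    and Comp_Id: "f \<in> hom C a b \<Longrightarrow> f \<cdot> Id C a = f"
    and Id_Comp: "f \<in> hom C a b \<Longrightarrow> Id C b \<cdot> f = f"
    and Comp_assoc: "\<lbrakk>f \<in> hom C a b; g \<in> hom C b c; h \<in> hom C c d\<rbrakk> \<Longrightarrow>
      (h \<cdot> g) \<cdot> f = h \<cdot> (g \<cdot> f)"

text \<open>\<open>orth_along C p e m\<close> is \<open>p \<bottom>\<^sup>e m\<close>, meaningful for morphisms with \<open>Cod C e = Dom C m\<close>.\<close>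

definition orth_along :: "('o, 'm, 'x) cat_scheme \<Rightarrow> 'm \<Rightarrow> 'm \<Rightarrow> 'm \<Rightarrow> bool" where
  "orth_along C p e m \<longleftrightarrow>
    (\<forall>u \<in> hom C (Dom C p) (Dom C e). \<forall>v \<in> hom C (Cod C p) (Cod C m).
      m \<cdot>\<^bsub>C\<^esub> e \<cdot>\<^bsub>C\<^esub> u = v \<cdot>\<^bsub>C\<^esub> p \<longrightarrow>
      (\<exists>!h. h \<in> hom C (Cod C p) (Dom C m) \<and> h \<cdot>\<^bsub>C\<^esub> p = e \<cdot>\<^bsub>C\<^esub> u \<and> m \<cdot>\<^bsub>C\<^esub> h = v))"

definition orth :: "('o, 'm, 'x) cat_scheme \<Rightarrow> 'm \<Rightarrow> 'm \<Rightarrow> bool" where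
  "orth C p m \<longleftrightarrow> orth_along C p (Id C (Dom C m)) m"

definition class_orth_along :: "('o, 'm, 'x) cat_scheme \<Rightarrow> 'm set \<Rightarrow> 'm \<Rightarrow> 'm \<Rightarrow> bool" where
  "class_orth_along C E e m \<longleftrightarrow> (\<forall>p \<in> E. orth_along C p e m)"

definition class_orth :: "('o, 'm, 'x) cat_scheme \<Rightarrow> 'm set \<Rightarrow> 'm \<Rightarrow> bool" where
  "class_orth C E m \<longleftrightarrow> (\<forall>p \<in> E. orth C p m)"


section \<open>Transfinite sequences\<close>

text \<open>
  A functor from \<open>\<upsilon>\<close> to \<open>C\<close> is given by its objects \<open>A \<alpha>\<close> and its morphisms \<open>t \<alpha> \<beta> : A \<alpha> \<rightarrow> A \<beta>\<close>
  for \<open>\<alpha> \<le> \<beta>\<close>; the values \<open>t \<alpha> \<beta>\<close> for \<open>\<beta> < \<alpha>\<close> are irrelevant.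
\<close>

definition poset_functor ::
    "('o, 'm, 'x) cat_scheme \<Rightarrow> ('i::wellorder \<Rightarrow> 'o) \<Rightarrow> ('i \<Rightarrow> 'i \<Rightarrow> 'm) \<Rightarrow> bool" where
  "poset_functor C A t \<longleftrightarrow>
    (\<forall>\<alpha>. A \<alpha> \<in> Obj C) \<and>
    (\<forall>\<alpha> \<beta>. \<alpha> \<le> \<beta> \<longrightarrow> t \<alpha> \<beta> \<in> hom C (A \<alpha>) (A \<beta>)) \<and>
    (\<forall>\<alpha>. t \<alpha> \<alpha> = Id C (A \<alpha>)) \<and>
    (\<forall>\<alpha> \<beta> \<gamma>. \<alpha> \<le> \<beta> \<and> \<beta> \<le> \<gamma> \<longrightarrow> t \<beta> \<gamma> \<cdot>\<^bsub>C\<^esub> t \<alpha> \<beta> = t \<alpha> \<gamma>)"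

text \<open>Cocones and colimits of the restriction of \<open>(A, t)\<close> to a set \<open>S\<close> of ordinals.\<close>

definition cocone ::
    "('o, 'm, 'x) cat_scheme \<Rightarrow> ('i::wellorder \<Rightarrow> 'o) \<Rightarrow> ('i \<Rightarrow> 'i \<Rightarrow> 'm) \<Rightarrow> 'i set \<Rightarrow>
      ('i \<Rightarrow> 'm) \<Rightarrow> 'o \<Rightarrow> bool" where
  "cocone C A t S g Y \<longleftrightarrow>
    Y \<in> Obj C \<and>
    (\<forall>\<alpha>\<in>S. g \<alpha> \<in> hom C (A \<alpha>) Y) \<and>
    (\<forall>\<alpha>\<in>S. \<forall>\<beta>\<in>S. \<alpha> \<le> \<beta> \<longrightarrow> g \<beta> \<cdot>\<^bsub>C\<^esub> t \<alpha> \<beta> = g \<alpha>)"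

definition colimit_cocone ::
    "('o, 'm, 'x) cat_scheme \<Rightarrow> ('i::wellorder \<Rightarrow> 'o) \<Rightarrow> ('i \<Rightarrow> 'i \<Rightarrow> 'm) \<Rightarrow> 'i set \<Rightarrow>
      ('i \<Rightarrow> 'm) \<Rightarrow> 'o \<Rightarrow> bool" where
  "colimit_cocone C A t S c L \<longleftrightarrow>
    cocone C A t S c L \<and>
    (\<forall>g Y. cocone C A t S g Y \<longrightarrow>
      (\<exists>!h. h \<in> hom C L Y \<and> (\<forall>\<alpha>\<in>S. h \<cdot>\<^bsub>C\<^esub> c \<alpha> = g \<alpha>)))"

definition transfinite_sequence ::
    "('o, 'm, 'x) cat_scheme \<Rightarrow> 'm set \<Rightarrow> ('i::wellorder \<Rightarrow> 'o) \<Rightarrow> ('i \<Rightarrow> 'i \<Rightarrow> 'm) \<Rightarrow> bool" where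
  "transfinite_sequence C E A t \<longleftrightarrow>
    poset_functor C A t \<and>
    (\<forall>\<gamma>. nonzero_limit \<gamma> \<longrightarrow> colimit_cocone C A t {..<\<gamma>} (\<lambda>\<beta>. t \<beta> \<gamma>) (A \<gamma>)) \<and>
    (\<forall>\<beta>. t \<beta> (ord_suc \<beta>) \<in> E)"


section \<open>Decompositions\<close>

text \<open>The data \<open>(A, f, X)\<close> of an \<open>E\<close>-predecomposition, indexed by all of \<open>\<upsilon>\<close>.\<close>

record ('i, 'o, 'm) predecomp =
  stage :: "'i \<Rightarrow> 'o"
  link :: "'i \<Rightarrow> 'i \<Rightarrow> 'm"
  leg :: "'i \<Rightarrow> 'm"
  apex :: 'o

definition predecomposition ::
    "('o, 'm, 'x) cat_scheme \<Rightarrow> 'm set \<Rightarrow> ('i::wellorder, 'o, 'm) predecomp \<Rightarrow> bool" where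
  "predecomposition C E P \<longleftrightarrow>
    transfinite_sequence C E (stage P) (link P) \<and>
    cocone C (stage P) (link P) UNIV (leg P) (apex P)"

definition predecomposition_of ::
    "('o, 'm, 'x) cat_scheme \<Rightarrow> 'm set \<Rightarrow> 'm \<Rightarrow> ('i::wellorder, 'o, 'm) predecomp \<Rightarrow> bool" where
  "predecomposition_of C E f P \<longleftrightarrow> predecomposition C E P \<and> leg P ord_zero = f"

definition canonical_predecomposition_of ::
    "('o, 'm, 'x) cat_scheme \<Rightarrow> 'm set \<Rightarrow> 'm \<Rightarrow> ('i::wellorder, 'o, 'm) predecomp \<Rightarrow> bool" where
  "canonical_predecomposition_of C E f P \<longleftrightarrow>
    predecomposition_of C E f P \<and>
    (\<forall>\<alpha>. class_orth_along C E (link P \<alpha> (ord_suc \<alpha>)) (leg P (ord_suc \<alpha>)))"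

definition stabilizes_at ::
    "('o, 'm, 'x) cat_scheme \<Rightarrow> 'm set \<Rightarrow> ('i::wellorder, 'o, 'm) predecomp \<Rightarrow> 'i \<Rightarrow> bool" where
  "stabilizes_at C E P \<alpha> \<longleftrightarrow> (\<forall>\<beta>\<ge>\<alpha>. class_orth C E (leg P \<beta>))"

definition stabilizes ::
    "('o, 'm, 'x) cat_scheme \<Rightarrow> 'm set \<Rightarrow> ('i::wellorder, 'o, 'm) predecomp \<Rightarrow> bool" where
  "stabilizes C E P \<longleftrightarrow> (\<exists>\<alpha>. stabilizes_at C E P \<alpha>)"

definition decomposition_of ::
    "('o, 'm, 'x) cat_scheme \<Rightarrow> 'm set \<Rightarrow> 'm \<Rightarrow> ('i::wellorder, 'o, 'm) predecomp \<Rightarrow> bool" where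
  "decomposition_of C E f P \<longleftrightarrow> predecomposition_of C E f P \<and> stabilizes C E P"

definition decomp_length ::
    "('o, 'm, 'x) cat_scheme \<Rightarrow> 'm set \<Rightarrow> ('i::wellorder, 'o, 'm) predecomp \<Rightarrow> 'i" where
  "decomp_length C E P = (LEAST \<alpha>. stabilizes_at C E P \<alpha>)"

text \<open>The decomposition numbers; \<open>None\<close> stands for ``undefined''.\<close>

definition min_decomp_number ::
    "('o, 'm, 'x) cat_scheme \<Rightarrow> 'm set \<Rightarrow> 'm \<Rightarrow> 'i::wellorder option" where
  "min_decomp_number C E f =
    (if \<exists>P :: ('i, 'o, 'm) predecomp. decomposition_of C E f P
     then Some (LEAST \<alpha>. \<exists>P :: ('i, 'o, 'm) predecomp.
       decomposition_of C E f P \<and> decomp_length C E P = \<alpha>)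
     else None)"

text \<open>The description \<open>THE\<close> relies on canonical predecompositions of \<open>f\<close> being unique up to
  isomorphism, so that they all have the same length.\<close>

definition canonical_decomp_number ::
    "('o, 'm, 'x) cat_scheme \<Rightarrow> 'm set \<Rightarrow> 'm \<Rightarrow> 'i::wellorder option" where
  "canonical_decomp_number C E f =
    (if \<exists>P :: ('i, 'o, 'm) predecomp. canonical_predecomposition_of C E f P \<and> stabilizes C E P
     then Some (THE \<alpha>. \<exists>P :: ('i, 'o, 'm) predecomp.
       canonical_predecomposition_of C E f P \<and> stabilizes C E P \<and> decomp_length C E P = \<alpha>)
     else None)"

end

theory Submission
  imports Defs
begin

text \<open>
  Let \<open>P = (A, f)\<close> be the canonical predecomposition of a morphism with codomain \<open>X\<close>, and let
  \<open>Q = (B, g)\<close> be any predecomposition of the same morphism.  Since a canonical predecomposition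
  fills squares whose left side is in \<open>E\<close> one step later, the identity of \<open>A 0 = B 0\<close> extends by
  transfinite recursion to maps \<open>\<phi> \<alpha> : B \<alpha> \<rightarrow> A \<alpha>\<close> over \<open>X\<close> (\<open>map_to_canonical\<close>).  If moreover
  \<open>E \<bottom> g d\<close>, then the same recursion gives maps \<open>\<psi> \<alpha> : A \<alpha> \<rightarrow> B d\<close> over \<open>X\<close>, because every step can be
  filled into the fixed object \<open>B d\<close>.

  Going forth and back, \<open>A \<beta> \<rightarrow> B d \<rightarrow> A d \<rightarrow> A \<beta>\<close> agrees with the identity when restricted to \<open>A 0\<close>.
  When \<open>d\<close> is a successor, uniqueness of fillers propagates the agreement to all \<open>\<beta> \<ge> d\<close>, so \<open>f \<beta>\<close> is a retract of
  \<open>g d\<close> over \<open>X\<close> and inherits orthogonality to \<open>E\<close>.  The successor hypothesis is essential to the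
  argument: the uniqueness at hand is relative to a link \<open>A \<mu> \<rightarrow> A (\<mu> + 1)\<close>, so it applies only to maps
  into a successor stage whose restriction factors through the preceding stage.  The outcome is
  \<open>canonical_stabilizes_at_successor\<close>: \<open>P\<close> stabilizes at the successor \<open>d\<close> as soon as \<open>E \<bottom> g d\<close>.

  Now let \<open>Q\<close> have the minimal length \<open>\<delta>\<close>.  As \<open>Q\<close> is still orthogonal at \<open>\<delta> + 1\<close>, the canonical \<open>P\<close>
  stabilizes at \<open>\<delta> + 1\<close>; and if \<open>\<delta>\<close> is itself a successor, \<open>P\<close> stabilizes already at \<open>\<delta>\<close>.  The
  inequality \<open>\<delta> \<le> \<sigma>\<close> holds because a stabilizing canonical predecomposition is a decomposition.
  That \<open>\<sigma>\<close> does not depend on the choice of \<open>P\<close> follows from the rigidity of canonical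
  predecompositions (\<open>canonical_endomap_id\<close>).
\<close>

section \<open>Successors in a well-order without greatest element\<close>

lemma universe_ordinal_no_greatest:
  assumes "universe_ordinal TYPE('i::wellorder)"
  shows "\<exists>\<beta>::'i. \<alpha> < \<beta>"
proof -
  let ?r = "{(\<alpha>, \<beta>). \<alpha> \<le> (\<beta>::'i)}"
  have "Field ?r = UNIV" by (auto simp: Field_def)
  moreover have "Card_order ?r" "infinite (UNIV :: 'i set)"
    using assms by (auto simp: universe_ordinal_def Let_def)
  ultimately have "\<exists>b\<in>Field ?r. \<alpha> \<noteq> b \<and> (\<alpha>, b) \<in> ?r"
    by (intro infinite_Card_order_limit) auto
  then show ?thesis using order.not_eq_order_implies_strict by blast
qed

lemma ord_zero_le: "ord_zero \<le> (\<alpha>::'i::wellorder)"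
  unfolding ord_zero_def by (rule Least_le) simp

text \<open>
  The type \<open>'i\<close> indexes all sequences; the absence of a greatest element makes \<open>ord_suc\<close> a true
  successor.
\<close>

locale unbounded_category = category C for C :: "('o, 'm, 'x) cat_scheme" (structure) +
  fixes E :: "'m set" and index :: "'i::wellorder itself"
  assumes E_arr: "E \<subseteq> Arr C"
    and no_greatest: "\<exists>\<beta>::'i. \<alpha> < \<beta>"
begin

lemma less_ord_suc: "(\<alpha>::'i) < ord_suc \<alpha>"
  unfolding ord_suc_def using no_greatest by (rule LeastI_ex)

lemma ord_suc_le: "(\<alpha>::'i) < \<beta> \<Longrightarrow> ord_suc \<alpha> \<le> \<beta>"
  unfolding ord_suc_def by (rule Least_le)

lemma less_ord_suc_iff: "(\<beta>::'i) < ord_suc \<alpha> \<longleftrightarrow> \<beta> \<le> \<alpha>"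
  using less_ord_suc ord_suc_le by (meson leD leI order.strict_trans1)

lemma ord_suc_le_iff: "ord_suc \<alpha> \<le> ord_suc \<beta> \<longleftrightarrow> (\<alpha>::'i) \<le> \<beta>"
  using less_ord_suc_iff less_ord_suc ord_suc_le by (metis not_le)

lemma ord_cases:
  obtains (zero) "(\<gamma>::'i) = ord_zero" | (suc) \<delta> where "\<gamma> = ord_suc \<delta>" | (limit) "nonzero_limit \<gamma>"
  unfolding nonzero_limit_def is_successor_def by blast

section \<open>Orthogonality and retracts\<close>

lemma E_hom: "p \<in> E \<Longrightarrow> p \<in> hom C (Dom C p) (Cod C p)"
  using E_arr by (auto simp: hom_def)

lemma filler_exists:
  assumes "orth_along C p e m" "p \<in> hom C a b" "e \<in> hom C A' A" "m \<in> hom C A X"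
    and "u \<in> hom C a A'" "v \<in> hom C b X" "m \<cdot> (e \<cdot> u) = v \<cdot> p"
  shows "\<exists>h\<in>hom C b A. h \<cdot> p = e \<cdot> u \<and> m \<cdot> h = v"
proof -
  have "m \<cdot> e \<cdot> u = v \<cdot> p" using assms Comp_assoc by metis
  moreover have "Dom C p = a" "Cod C p = b" "Dom C e = A'" "Dom C m = A" "Cod C m = X"
    using assms by (auto simp: hom_def)
  ultimately show ?thesis using assms(1,5,6) unfolding orth_along_def by metis
qed

lemma filler_unique:
  assumes "orth_along C p e m" "p \<in> hom C a b" "e \<in> hom C A' A" "m \<in> hom C A X"
    and "u \<in> hom C a A'" "h \<in> hom C b A" "h' \<in> hom C b A"
    and "h \<cdot> p = e \<cdot> u" "h' \<cdot> p = e \<cdot> u" "m \<cdot> h = m \<cdot> h'"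
  shows "h = h'"
proof -
  have "m \<cdot> h \<in> hom C b X" using assms Comp_in_hom by blast
  moreover have "m \<cdot> e \<cdot> u = m \<cdot> h \<cdot> p" using assms Comp_assoc by metis
  moreover have "Dom C p = a" "Cod C p = b" "Dom C e = A'" "Dom C m = A" "Cod C m = X"
    using assms by (auto simp: hom_def)
  ultimately show ?thesis using assms unfolding orth_along_def by metis
qed

lemma orth_iff:
  assumes "p \<in> hom C a b" "m \<in> hom C A X"
  shows "orth C p m \<longleftrightarrow> (\<forall>u\<in>hom C a A. \<forall>v\<in>hom C b X. m \<cdot> u = v \<cdot> p \<longrightarrow>
    (\<exists>!h. h \<in> hom C b A \<and> h \<cdot> p = u \<and> m \<cdot> h = v))"
proof -
  have ends: "Dom C p = a" "Cod C p = b" "Dom C m = A" "Cod C m = X" "A \<in> Obj C"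
    using assms Dom_in_Obj by (auto simp: hom_def)
  then have "Dom C (Id C A) = A" using Id_in_hom by (auto simp: hom_def)
  moreover have "m \<cdot> Id C A = m" using assms Comp_Id by blast
  ultimately show ?thesis
    unfolding orth_def orth_along_def using ends by (simp add: Id_Comp cong: ball_cong)
qed

text \<open>
  A lifting problem against \<open>f\<close> is pushed along \<open>j\<close> to one against \<open>g\<close>, and its solution is pulled
  back along \<open>i\<close>.  Uniqueness survives because \<open>j\<close> is a split monomorphism over the base.
\<close>

lemma class_orth_retract:
  assumes g: "class_orth C E g" "g \<in> hom C B X" and f: "f \<in> hom C A X"
    and i: "i \<in> hom C B A" "f \<cdot> i = g" and j: "j \<in> hom C A B" and ij: "i \<cdot> j = Id C A"
  shows "class_orth C E f"
  unfolding class_orth_def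
proof
  fix p assume p: "p \<in> E"
  let ?a = "Dom C p" and ?b = "Cod C p"
  note ph = E_hom[OF p]
  have gj: "g \<cdot> j = f" using Comp_assoc[OF j i(1) f] i(2) ij Comp_Id[OF f] by simp
  have pg: "orth C p g" using g(1) p unfolding class_orth_def by blast
  have orth: "\<exists>!h. h \<in> hom C ?b B \<and> h \<cdot> p = u \<and> g \<cdot> h = v"
    if "u \<in> hom C ?a B" "v \<in> hom C ?b X" "g \<cdot> u = v \<cdot> p" for u v
    using iffD1[OF orth_iff[OF ph g(2)] pg] that by simp
  have ijh: "i \<cdot> (j \<cdot> h) = h" if "h \<in> hom C c A" for h c
    using Comp_assoc[OF that j i(1)] ij Id_Comp[OF that] by simp
  have "\<exists>!h. h \<in> hom C ?b A \<and> h \<cdot> p = u \<and> f \<cdot> h = v"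
    if u: "u \<in> hom C ?a A" and v: "v \<in> hom C ?b X" and eq: "f \<cdot> u = v \<cdot> p" for u v
  proof -
    have ju: "j \<cdot> u \<in> hom C ?a B" using u j Comp_in_hom by blast
    have "g \<cdot> (j \<cdot> u) = v \<cdot> p" using Comp_assoc[OF u j g(2)] gj eq by simp
    note ex1 = orth[OF ju v this]
    then obtain h where h: "h \<in> hom C ?b B" "h \<cdot> p = j \<cdot> u" "g \<cdot> h = v" by blast
    show ?thesis
    proof (rule ex1I[of _ "i \<cdot> h"], intro conjI)
      show "i \<cdot> h \<in> hom C ?b A" using h i Comp_in_hom by blast
      show "i \<cdot> h \<cdot> p = u" using Comp_assoc[OF ph h(1) i(1)] h(2) ijh[OF u] by simp
      show "f \<cdot> (i \<cdot> h) = v" using Comp_assoc[OF h(1) i(1) f] i(2) h(3) by simp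
    next
      fix k assume k: "k \<in> hom C ?b A \<and> k \<cdot> p = u \<and> f \<cdot> k = v"
      have kA: "k \<in> hom C ?b A" using k by blast
      have "j \<cdot> k \<in> hom C ?b B" using kA j Comp_in_hom by blast
      moreover have "j \<cdot> k \<cdot> p = j \<cdot> u" using k Comp_assoc[OF ph kA j] by simp
      moreover have "g \<cdot> (j \<cdot> k) = v" using k Comp_assoc[OF kA j g(2)] gj by simp
      ultimately have "j \<cdot> k = h" using ex1 h by metis
      then show "k = i \<cdot> h" using ijh[OF kA] by simp
    qed
  qed
  then show "orth C p f" using orth_iff[OF ph f] by simp
qed

section \<open>Diagrams over an object and their maps\<close>

definition diagram_over :: "'o \<Rightarrow> ('i, 'o, 'm) predecomp \<Rightarrow> bool" where
  "diagram_over X T \<longleftrightarrow> apex T = X \<and> poset_functor C (stage T) (link T) \<and>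
    cocone C (stage T) (link T) UNIV (leg T) X"

definition diagram_map ::
    "('i, 'o, 'm) predecomp \<Rightarrow> ('i, 'o, 'm) predecomp \<Rightarrow> ('i \<Rightarrow> 'm) \<Rightarrow> bool" where
  "diagram_map Q T \<phi> \<longleftrightarrow>
    (\<forall>\<alpha>. \<phi> \<alpha> \<in> hom C (stage Q \<alpha>) (stage T \<alpha>) \<and> leg T \<alpha> \<cdot> \<phi> \<alpha> = leg Q \<alpha>) \<and>
    (\<forall>\<alpha> \<beta>. \<alpha> \<le> \<beta> \<longrightarrow> \<phi> \<beta> \<cdot> link Q \<alpha> \<beta> = link T \<alpha> \<beta> \<cdot> \<phi> \<alpha>)"

text \<open>
  The lifting condition of canonical predecompositions, separated from continuity and from the
  membership of the links in \<open>E\<close>, so that constant diagrams can satisfy it as well.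
\<close>

definition absorbing :: "('i, 'o, 'm) predecomp \<Rightarrow> bool" where
  "absorbing T \<longleftrightarrow>
    (\<forall>\<alpha>. class_orth_along C E (link T \<alpha> (ord_suc \<alpha>)) (leg T (ord_suc \<alpha>)))"

lemma diagram_overD:
  assumes "diagram_over X T"
  shows "apex T = X" "X \<in> Obj C" "stage T \<alpha> \<in> Obj C" "leg T \<alpha> \<in> hom C (stage T \<alpha>) X"
    and "\<alpha> \<le> \<beta> \<Longrightarrow> link T \<alpha> \<beta> \<in> hom C (stage T \<alpha>) (stage T \<beta>)"
    and "link T \<alpha> \<alpha> = Id C (stage T \<alpha>)"
    and "\<alpha> \<le> \<beta> \<Longrightarrow> \<beta> \<le> \<gamma> \<Longrightarrow> link T \<beta> \<gamma> \<cdot> link T \<alpha> \<beta> = link T \<alpha> \<gamma>"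
    and "\<alpha> \<le> \<beta> \<Longrightarrow> leg T \<beta> \<cdot> link T \<alpha> \<beta> = leg T \<alpha>"
  using assms unfolding diagram_over_def poset_functor_def cocone_def by simp_all

lemma diagram_mapD:
  assumes "diagram_map Q T \<phi>"
  shows "\<phi> \<alpha> \<in> hom C (stage Q \<alpha>) (stage T \<alpha>)" "leg T \<alpha> \<cdot> \<phi> \<alpha> = leg Q \<alpha>"
    and "\<alpha> \<le> \<beta> \<Longrightarrow> \<phi> \<beta> \<cdot> link Q \<alpha> \<beta> = link T \<alpha> \<beta> \<cdot> \<phi> \<alpha>"
  using assms unfolding diagram_map_def by simp_all

lemma predecomposition_diagram_over:
  fixes Q :: "('i, 'o, 'm) predecomp"
  assumes "predecomposition C E Q"
  shows "diagram_over (apex Q) Q"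
  using assms unfolding predecomposition_def transfinite_sequence_def diagram_over_def by simp

lemma predecomposition_step:
  fixes Q :: "('i, 'o, 'm) predecomp"
  assumes "predecomposition C E Q"
  shows "link Q \<alpha> (ord_suc \<alpha>) \<in> E"
  using assms unfolding predecomposition_def transfinite_sequence_def by simp

lemma predecomposition_colimit:
  fixes Q :: "('i, 'o, 'm) predecomp"
  assumes "predecomposition C E Q"
  shows "nonzero_limit \<gamma> \<Longrightarrow>
    colimit_cocone C (stage Q) (link Q) {..<\<gamma>} (\<lambda>\<beta>. link Q \<beta> \<gamma>) (stage Q \<gamma>)"
  using assms unfolding predecomposition_def transfinite_sequence_def by simp

lemma limit_map_unique:
  fixes Q :: "('i, 'o, 'm) predecomp"
  assumes Q: "predecomposition C E Q" and lim: "nonzero_limit \<gamma>"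
    and h: "h \<in> hom C (stage Q \<gamma>) Y" and h': "h' \<in> hom C (stage Q \<gamma>) Y"
    and eq: "\<And>\<alpha>. \<alpha> < \<gamma> \<Longrightarrow> h \<cdot> link Q \<alpha> \<gamma> = h' \<cdot> link Q \<alpha> \<gamma>"
  shows "h = h'"
proof -
  note D = diagram_overD[OF predecomposition_diagram_over[OF Q]]
  have "Y \<in> Obj C" using h Cod_in_Obj by (auto simp: hom_def)
  moreover have "h \<cdot> link Q \<alpha> \<gamma> \<in> hom C (stage Q \<alpha>) Y" if "\<alpha> < \<gamma>" for \<alpha>
    using D(5) h Comp_in_hom that by (meson less_imp_le)
  moreover have "h \<cdot> link Q \<beta> \<gamma> \<cdot> link Q \<alpha> \<beta> = h \<cdot> link Q \<alpha> \<gamma>" if "\<beta> < \<gamma>" "\<alpha> \<le> \<beta>" for \<alpha> \<beta>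
    using Comp_assoc[OF D(5) D(5) h] D(7) that by (simp add: less_imp_le)
  ultimately have "cocone C (stage Q) (link Q) {..<\<gamma>} (\<lambda>\<alpha>. h \<cdot> link Q \<alpha> \<gamma>) Y"
    unfolding cocone_def by auto
  then have "\<exists>!k. k \<in> hom C (stage Q \<gamma>) Y \<and> (\<forall>\<alpha>\<in>{..<\<gamma>}. k \<cdot> link Q \<alpha> \<gamma> = h \<cdot> link Q \<alpha> \<gamma>)"
    using predecomposition_colimit[OF Q lim] unfolding colimit_cocone_def by blast
  then show ?thesis using h h' eq by (metis lessThan_iff)
qed

text \<open>
  Two maps out of a predecomposition can differ for the first time only at a successor, since a
  limit stage is the colimit of the earlier ones.  The step is left as a hypothesis because
  uniqueness of fillers has a different source in each application.
\<close>

lemma diagram_maps_agree: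
  fixes Q :: "('i, 'o, 'm) predecomp"
  assumes Q: "predecomposition C E Q"
    and \<phi>: "diagram_map Q T \<phi>" and \<psi>: "diagram_map Q T \<psi>"
    and zero: "\<phi> ord_zero = \<psi> ord_zero"
    and step: "\<And>\<alpha>. \<phi> \<alpha> = \<psi> \<alpha> \<Longrightarrow> \<phi> (ord_suc \<alpha>) = \<psi> (ord_suc \<alpha>)"
  shows "\<phi> \<gamma> = \<psi> \<gamma>"
proof (induction \<gamma> rule: less_induct)
  case (less \<gamma>)
  show ?case
  proof (cases \<gamma> rule: ord_cases)
    case zero
    then show ?thesis using assms(4) by simp
  next
    case (suc \<delta>)
    then show ?thesis using less step less_ord_suc by blast
  next
    case limit
    show ?thesis
    proof (rule limit_map_unique[OF Q limit diagram_mapD(1)[OF \<phi>] diagram_mapD(1)[OF \<psi>]])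
      fix \<alpha> assume "\<alpha> < \<gamma>"
      then show "\<phi> \<gamma> \<cdot> link Q \<alpha> \<gamma> = \<psi> \<gamma> \<cdot> link Q \<alpha> \<gamma>"
        using less diagram_mapD(3)[OF \<phi>] diagram_mapD(3)[OF \<psi>] by simp
    qed
  qed
qed

text \<open>
  Transfinite recursion: a link of \<open>Q\<close> lies in \<open>E\<close>, so at a successor the absorbing target supplies
  a filler, and at a limit the colimit property of \<open>Q\<close> supplies the next component.  The recursion
  keeps naturality towards all earlier stages in the invariant, as the limit case needs the
  components found so far to form a cocone.
\<close>

lemma diagram_map_exists:
  fixes Q :: "('i, 'o, 'm) predecomp"
  assumes Q: "predecomposition C E Q" and T: "diagram_over (apex Q) T" and abs: "absorbing T"
    and \<phi>0: "\<phi>0 \<in> hom C (stage Q ord_zero) (stage T ord_zero)"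
    and leg0: "leg T ord_zero \<cdot> \<phi>0 = leg Q ord_zero"
  shows "\<exists>\<phi>. diagram_map Q T \<phi> \<and> \<phi> ord_zero = \<phi>0"
proof -
  note DQ = diagram_overD[OF predecomposition_diagram_over[OF Q]]
  note DT = diagram_overD[OF T]
  define ext where "ext \<phi> \<gamma> r \<longleftrightarrow>
    r \<in> hom C (stage Q \<gamma>) (stage T \<gamma>) \<and> leg T \<gamma> \<cdot> r = leg Q \<gamma> \<and>
    (\<forall>\<alpha><\<gamma>. r \<cdot> link Q \<alpha> \<gamma> = link T \<alpha> \<gamma> \<cdot> \<phi> \<alpha>) \<and> (\<gamma> = ord_zero \<longrightarrow> r = \<phi>0)" for \<phi> \<gamma> r
  have natural: "\<phi> \<beta> \<cdot> link Q \<alpha> \<beta> = link T \<alpha> \<beta> \<cdot> \<phi> \<alpha>"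
    if "\<alpha> \<le> \<beta>" "ext \<phi> \<beta> (\<phi> \<beta>)" for \<phi> \<alpha> \<beta>
  proof (cases "\<alpha> = \<beta>")
    case True
    then show ?thesis using that DQ(6) DT(6) Comp_Id Id_Comp unfolding ext_def by metis
  next
    case False
    then show ?thesis using that unfolding ext_def by simp
  qed
  have "\<exists>\<phi>. \<forall>\<gamma>. ext \<phi> \<gamma> (\<phi> \<gamma>)"
  proof (rule dependent_wf_choice[of "{(\<alpha>, \<beta>). \<alpha> < (\<beta>::'i)}"])
    show "wf {(\<alpha>, \<beta>). \<alpha> < (\<beta>::'i)}" by (rule wf)
  next
    fix \<phi> \<psi> :: "'i \<Rightarrow> 'm" and \<gamma> r
    assume "\<And>\<alpha>. (\<alpha>, \<gamma>) \<in> {(\<alpha>, \<beta>). \<alpha> < (\<beta>::'i)} \<Longrightarrow> \<phi> \<alpha> = \<psi> \<alpha>"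
    then show "ext \<phi> \<gamma> r = ext \<psi> \<gamma> r" unfolding ext_def by auto
  next
    fix \<gamma> and \<phi> :: "'i \<Rightarrow> 'm"
    assume "\<And>\<alpha>. (\<alpha>, \<gamma>) \<in> {(\<alpha>, \<beta>). \<alpha> < (\<beta>::'i)} \<Longrightarrow> ext \<phi> \<alpha> (\<phi> \<alpha>)"
    then have IH: "ext \<phi> \<alpha> (\<phi> \<alpha>)" if "\<alpha> < \<gamma>" for \<alpha> using that by simp
    have \<phi>h: "\<phi> \<alpha> \<in> hom C (stage Q \<alpha>) (stage T \<alpha>)" "leg T \<alpha> \<cdot> \<phi> \<alpha> = leg Q \<alpha>"
      if "\<alpha> < \<gamma>" for \<alpha>
      using IH[OF that] unfolding ext_def by auto
    show "\<exists>r. ext \<phi> \<gamma> r"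
    proof (cases \<gamma> rule: ord_cases)
      case zero
      then show ?thesis
        using \<phi>0 leg0 leD[OF ord_zero_le] unfolding ext_def by (intro exI[of _ \<phi>0]) auto
    next
      case (suc \<delta>)
      have lt: "\<delta> < \<gamma>" using suc less_ord_suc by simp
      then have le: "\<delta> \<le> \<gamma>" by simp
      have p: "link Q \<delta> \<gamma> \<in> E" using predecomposition_step[OF Q] suc by simp
      then have orth: "orth_along C (link Q \<delta> \<gamma>) (link T \<delta> \<gamma>) (leg T \<gamma>)"
        using abs suc unfolding absorbing_def class_orth_along_def by blast
      have "leg T \<gamma> \<cdot> (link T \<delta> \<gamma> \<cdot> \<phi> \<delta>) = leg Q \<gamma> \<cdot> link Q \<delta> \<gamma>"
        using Comp_assoc[OF \<phi>h(1)[OF lt] DT(5)[OF le] DT(4)] \<phi>h(2)[OF lt] DT(8)[OF le] DQ(8)[OF le]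
        by simp
      then obtain r where r: "r \<in> hom C (stage Q \<gamma>) (stage T \<gamma>)"
        "r \<cdot> link Q \<delta> \<gamma> = link T \<delta> \<gamma> \<cdot> \<phi> \<delta>" "leg T \<gamma> \<cdot> r = leg Q \<gamma>"
        using filler_exists[OF orth DQ(5)[OF le] DT(5)[OF le] DT(4) \<phi>h(1)[OF lt] DQ(4)] by blast
      have "r \<cdot> link Q \<alpha> \<gamma> = link T \<alpha> \<gamma> \<cdot> \<phi> \<alpha>" if "\<alpha> < \<gamma>" for \<alpha>
      proof -
        have al: "\<alpha> \<le> \<delta>" using that suc less_ord_suc_iff by simp
        have "r \<cdot> link Q \<alpha> \<gamma> = r \<cdot> link Q \<delta> \<gamma> \<cdot> link Q \<alpha> \<delta>"
          using Comp_assoc[OF DQ(5)[OF al] DQ(5)[OF le] r(1)] DQ(7)[OF al le] by simp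
        also have "\<dots> = link T \<delta> \<gamma> \<cdot> (\<phi> \<delta> \<cdot> link Q \<alpha> \<delta>)"
          using Comp_assoc[OF DQ(5)[OF al] \<phi>h(1)[OF lt] DT(5)[OF le]] r(2) by simp
        also have "\<dots> = link T \<alpha> \<gamma> \<cdot> \<phi> \<alpha>"
          using natural[OF al IH[OF lt]] Comp_assoc[OF \<phi>h(1)[OF that] DT(5)[OF al] DT(5)[OF le]]
            DT(7)[OF al le] by simp
        finally show ?thesis .
      qed
      moreover have "\<gamma> \<noteq> ord_zero" using lt ord_zero_le leD by blast
      ultimately show ?thesis using r unfolding ext_def by (intro exI[of _ r]) simp
    next
      case limit
      let ?g = "\<lambda>\<alpha>. link T \<alpha> \<gamma> \<cdot> \<phi> \<alpha>"
      have gh: "?g \<alpha> \<in> hom C (stage Q \<alpha>) (stage T \<gamma>)" if "\<alpha> < \<gamma>" for \<alpha>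
        using Comp_in_hom[OF \<phi>h(1)[OF that] DT(5)] that by simp
      have "?g \<beta> \<cdot> link Q \<alpha> \<beta> = ?g \<alpha>" if "\<alpha> \<le> \<beta>" "\<beta> < \<gamma>" for \<alpha> \<beta>
      proof -
        have le: "\<beta> \<le> \<gamma>" and lt: "\<alpha> < \<gamma>" using that by auto
        have "?g \<beta> \<cdot> link Q \<alpha> \<beta> = link T \<beta> \<gamma> \<cdot> (link T \<alpha> \<beta> \<cdot> \<phi> \<alpha>)"
          using Comp_assoc[OF DQ(5)[OF that(1)] \<phi>h(1)[OF that(2)] DT(5)[OF le]]
            natural[OF that(1) IH[OF that(2)]] by simp
        then show ?thesis
          using Comp_assoc[OF \<phi>h(1)[OF lt] DT(5)[OF that(1)] DT(5)[OF le]] DT(7)[OF that(1) le]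
          by simp
      qed
      then have "cocone C (stage Q) (link Q) {..<\<gamma>} ?g (stage T \<gamma>)"
        unfolding cocone_def using gh DT(3) by auto
      then obtain r where r: "r \<in> hom C (stage Q \<gamma>) (stage T \<gamma>)"
        "\<And>\<alpha>. \<alpha> < \<gamma> \<Longrightarrow> r \<cdot> link Q \<alpha> \<gamma> = ?g \<alpha>"
        using predecomposition_colimit[OF Q limit] unfolding colimit_cocone_def by blast
      have "leg T \<gamma> \<cdot> r = leg Q \<gamma>"
      proof (rule limit_map_unique[OF Q limit Comp_in_hom[OF r(1) DT(4)] DQ(4)])
        fix \<alpha> assume lt: "\<alpha> < \<gamma>"
        then have le: "\<alpha> \<le> \<gamma>" by simp
        show "leg T \<gamma> \<cdot> r \<cdot> link Q \<alpha> \<gamma> = leg Q \<gamma> \<cdot> link Q \<alpha> \<gamma>"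
          using Comp_assoc[OF DQ(5)[OF le] r(1) DT(4)] r(2)[OF lt]
            Comp_assoc[OF \<phi>h(1)[OF lt] DT(5)[OF le] DT(4)] DT(8)[OF le] DQ(8)[OF le] \<phi>h(2)[OF lt]
          by simp
      qed
      moreover have "\<gamma> \<noteq> ord_zero" using limit unfolding nonzero_limit_def by blast
      ultimately show ?thesis using r unfolding ext_def by (intro exI[of _ r]) simp
    qed
  qed
  then obtain \<phi> where \<phi>: "\<And>\<gamma>. ext \<phi> \<gamma> (\<phi> \<gamma>)" by blast
  then have "\<phi> \<alpha> \<in> hom C (stage Q \<alpha>) (stage T \<alpha>) \<and> leg T \<alpha> \<cdot> \<phi> \<alpha> = leg Q \<alpha>" for \<alpha>
    unfolding ext_def by simp
  then have "diagram_map Q T \<phi>"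
    unfolding diagram_map_def using natural \<phi> by simp
  moreover have "\<phi> ord_zero = \<phi>0" using \<phi> unfolding ext_def by blast
  ultimately show ?thesis by blast
qed

lemma diagram_map_id:
  assumes "diagram_over X T"
  shows "diagram_map T T (\<lambda>\<alpha>. Id C (stage T \<alpha>))"
proof -
  note D = diagram_overD[OF assms]
  show ?thesis
    unfolding diagram_map_def
    using Id_in_hom[OF D(3)] Comp_Id[OF D(4)] Comp_Id[OF D(5)] Id_Comp[OF D(5)] by simp
qed

lemma diagram_map_comp:
  assumes "diagram_over X Q" "diagram_over X R" "diagram_over X T"
    and "diagram_map Q R \<phi>" "diagram_map R T \<psi>"
  shows "diagram_map Q T (\<lambda>\<alpha>. \<psi> \<alpha> \<cdot> \<phi> \<alpha>)"
proof -
  note Q = diagram_overD[OF assms(1)] and R = diagram_overD[OF assms(2)]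
    and T = diagram_overD[OF assms(3)]
  note \<phi> = diagram_mapD[OF assms(4)] and \<psi> = diagram_mapD[OF assms(5)]
  have "\<psi> \<beta> \<cdot> \<phi> \<beta> \<cdot> link Q \<alpha> \<beta> = link T \<alpha> \<beta> \<cdot> (\<psi> \<alpha> \<cdot> \<phi> \<alpha>)" if le: "\<alpha> \<le> \<beta>" for \<alpha> \<beta>
    using Comp_assoc[OF Q(5)[OF le] \<phi>(1) \<psi>(1)] \<phi>(3)[OF le] Comp_assoc[OF \<phi>(1) R(5)[OF le] \<psi>(1)]
      \<psi>(3)[OF le] Comp_assoc[OF \<phi>(1) \<psi>(1) T(5)[OF le]] by simp
  moreover have "leg T \<alpha> \<cdot> (\<psi> \<alpha> \<cdot> \<phi> \<alpha>) = leg Q \<alpha>" for \<alpha>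
    using Comp_assoc[OF \<phi>(1) \<psi>(1) T(4)] \<phi>(2) \<psi>(2) by simp
  ultimately show ?thesis
    unfolding diagram_map_def using Comp_in_hom[OF \<phi>(1) \<psi>(1)] by simp
qed

text \<open>
  The identity links of a constant diagram turn the relative lifting condition into plain
  orthogonality of its leg.
\<close>

lemma absorbing_constant:
  assumes g: "g \<in> hom C B X" "class_orth C E g"
  defines "K \<equiv> \<lparr>stage = \<lambda>_. B, link = \<lambda>_ _. Id C B, leg = \<lambda>_. g, apex = X\<rparr>"
  shows "diagram_over X K" "absorbing K"
proof -
  have obj: "B \<in> Obj C" "X \<in> Obj C" "Dom C g = B"
    using g Dom_in_Obj Cod_in_Obj by (auto simp: hom_def)
  note I = Id_in_hom[OF obj(1)]
  show "diagram_over X K"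
    unfolding diagram_over_def poset_functor_def cocone_def K_def
    using obj I g(1) Comp_Id[OF I] Comp_Id[OF g(1)] by simp
  show "absorbing K"
    using g(2) obj unfolding absorbing_def K_def class_orth_def class_orth_along_def orth_def by simp
qed

section \<open>Comparison with the canonical predecomposition\<close>

lemma canonicalD:
  fixes P :: "('i, 'o, 'm) predecomp"
  assumes "canonical_predecomposition_of C E f P"
  shows "predecomposition_of C E f P" "predecomposition C E P" "absorbing P"
  using assms unfolding canonical_predecomposition_of_def absorbing_def predecomposition_of_def
  by simp_all

lemma predecomposition_of_ends:
  fixes Q :: "('i, 'o, 'm) predecomp"
  assumes "predecomposition_of C E f Q"
  shows "stage Q ord_zero = Dom C f" "apex Q = Cod C f" "leg Q ord_zero = f"
    "diagram_over (Cod C f) Q" "predecomposition C E Q"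
proof -
  have Q: "predecomposition C E Q" and f: "leg Q ord_zero = f"
    using assms unfolding predecomposition_of_def by simp_all
  note D = predecomposition_diagram_over[OF Q]
  show "leg Q ord_zero = f" by fact
  show "stage Q ord_zero = Dom C f" and *: "apex Q = Cod C f"
    using diagram_overD(4)[OF D, of ord_zero] f by (auto simp: hom_def)
  show "diagram_over (Cod C f) Q" using D * by simp
  show "predecomposition C E Q" by fact
qed

text \<open>
  A canonical predecomposition is weakly terminal among the predecompositions of the same morphism.
\<close>

lemma map_to_canonical:
  fixes P Q :: "('i, 'o, 'm) predecomp"
  assumes P: "canonical_predecomposition_of C E f P" and Q: "predecomposition_of C E f Q"
  obtains \<phi> where "diagram_map Q P \<phi>" "\<phi> ord_zero = Id C (Dom C f)"
proof -
  note p = predecomposition_of_ends[OF canonicalD(1)[OF P]] and q = predecomposition_of_ends[OF Q]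
  have "leg P ord_zero \<in> hom C (stage P ord_zero) (Cod C f)" using diagram_overD(4)[OF p(4)] .
  then have "leg P ord_zero \<cdot> Id C (Dom C f) = leg Q ord_zero" using p q Comp_Id by metis
  moreover have "Id C (Dom C f) \<in> hom C (stage Q ord_zero) (stage P ord_zero)"
    using p q Id_in_hom diagram_overD(3)[OF p(4)] by metis
  ultimately show ?thesis
    using that diagram_map_exists[OF q(5) _ canonicalD(3)[OF P]] p(4) q(2) by metis
qed

text \<open>
  Both an endomorphism and the identity solve the same lifting problem along each link, so the
  uniqueness built into canonicity keeps them equal.
\<close>

lemma canonical_endomap_id:
  fixes P :: "('i, 'o, 'm) predecomp"
  assumes P: "canonical_predecomposition_of C E f P"
    and \<theta>: "diagram_map P P \<theta>" and zero: "\<theta> ord_zero = Id C (Dom C f)"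
  shows "\<theta> \<gamma> = Id C (stage P \<gamma>)"
proof -
  note p = predecomposition_of_ends[OF canonicalD(1)[OF P]]
  note D = diagram_overD[OF p(4)]
  note id = diagram_map_id[OF p(4)]
  show ?thesis
  proof (rule diagram_maps_agree[OF p(5) \<theta> id])
    show "\<theta> ord_zero = Id C (stage P ord_zero)" using zero p by simp
  next
    fix \<alpha> assume IH: "\<theta> \<alpha> = Id C (stage P \<alpha>)"
    let ?s = "ord_suc \<alpha>"
    have le: "\<alpha> \<le> ?s" using less_ord_suc by (rule less_imp_le)
    have orth: "orth_along C (link P \<alpha> ?s) (link P \<alpha> ?s) (leg P ?s)"
      using canonicalD(3)[OF P] predecomposition_step[OF p(5)]
      unfolding absorbing_def class_orth_along_def by blast
    show "\<theta> ?s = Id C (stage P ?s)"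
    proof (rule filler_unique[OF orth D(5)[OF le] D(5)[OF le] D(4) diagram_mapD(1)[OF \<theta>]
          diagram_mapD(1)[OF \<theta>] diagram_mapD(1)[OF id]])
      show "\<theta> ?s \<cdot> link P \<alpha> ?s = link P \<alpha> ?s \<cdot> \<theta> \<alpha>" using diagram_mapD(3)[OF \<theta> le] .
      show "Id C (stage P ?s) \<cdot> link P \<alpha> ?s = link P \<alpha> ?s \<cdot> \<theta> \<alpha>"
        using diagram_mapD(3)[OF id le] IH by simp
      show "leg P ?s \<cdot> \<theta> ?s = leg P ?s \<cdot> Id C (stage P ?s)"
        using diagram_mapD(2)[OF \<theta>] diagram_mapD(2)[OF id] by simp
    qed
  qed
qed

text \<open>
  The comparison maps between two canonical predecompositions compose to the identity by rigidity,
  which makes every leg of one a retract of the corresponding leg of the other.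
\<close>

lemma canonical_orth_transfer:
  fixes P P' :: "('i, 'o, 'm) predecomp"
  assumes P: "canonical_predecomposition_of C E f P" and P': "canonical_predecomposition_of C E f P'"
    and orth: "class_orth C E (leg P' \<alpha>)"
  shows "class_orth C E (leg P \<alpha>)"
proof -
  note p = predecomposition_of_ends[OF canonicalD(1)[OF P]]
  note p' = predecomposition_of_ends[OF canonicalD(1)[OF P']]
  obtain \<phi> where \<phi>: "diagram_map P' P \<phi>" "\<phi> ord_zero = Id C (Dom C f)"
    using map_to_canonical[OF P canonicalD(1)[OF P']] .
  obtain \<psi> where \<psi>: "diagram_map P P' \<psi>" "\<psi> ord_zero = Id C (Dom C f)"
    using map_to_canonical[OF P' canonicalD(1)[OF P]] .
  have "Dom C f \<in> Obj C" using p diagram_overD(3)[OF p(4)] by metis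
  then have "\<phi> ord_zero \<cdot> \<psi> ord_zero = Id C (Dom C f)"
    using \<phi>(2) \<psi>(2) Comp_Id Id_in_hom by metis
  then have "\<phi> \<alpha> \<cdot> \<psi> \<alpha> = Id C (stage P \<alpha>)"
    using canonical_endomap_id[OF P diagram_map_comp[OF p(4) p'(4) p(4) \<psi>(1) \<phi>(1)]] by simp
  then show ?thesis
    using class_orth_retract[OF orth diagram_overD(4)[OF p'(4)] diagram_overD(4)[OF p(4)]]
      diagram_mapD[OF \<phi>(1)] diagram_mapD[OF \<psi>(1)] by blast
qed

lemma canonical_stabilizes_at_unique:
  fixes P P' :: "('i, 'o, 'm) predecomp"
  assumes "canonical_predecomposition_of C E f P" "canonical_predecomposition_of C E f P'"
  shows "stabilizes_at C E P = stabilizes_at C E P'"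
proof -
  have "class_orth C E (leg P \<beta>) \<longleftrightarrow> class_orth C E (leg P' \<beta>)" for \<beta>
    by (rule iffI[OF canonical_orth_transfer[OF assms(2,1)] canonical_orth_transfer[OF assms]])
  then show ?thesis unfolding stabilizes_at_def by simp
qed

text \<open>
  For \<open>d = \<epsilon> + 1\<close> and \<open>\<beta> \<ge> d\<close>, the leg of \<open>P\<close> at \<open>\<beta>\<close> is shown to be a retract of the leg of \<open>Q\<close> at
  \<open>d\<close>.  The composite \<open>A \<alpha> \<rightarrow> B d \<rightarrow> A d\<close> is compared with the links of \<open>P\<close> inside the diagram
  \<open>\<alpha> \<mapsto> A (max d \<alpha>)\<close>.  This shift of \<open>P\<close> is chosen because it receives both the composite, which lands
  in \<open>A d\<close>, and the link out of \<open>A \<alpha>\<close>, and because its stages \<open>max d (\<alpha> + 1) = max \<epsilon> \<alpha> + 1\<close> are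
  successors, where the relative uniqueness of \<open>P\<close> can be used.
\<close>

lemma canonical_stabilizes_at_successor:
  fixes P Q :: "('i, 'o, 'm) predecomp"
  assumes P: "canonical_predecomposition_of C E f P" and Q: "predecomposition_of C E f Q"
    and orth: "class_orth C E (leg Q (ord_suc \<epsilon>))"
  shows "stabilizes_at C E P (ord_suc \<epsilon>)"
proof -
  define d where "d = ord_suc \<epsilon>"
  let ?X = "Cod C f" and ?B = "stage Q d"
  note p = predecomposition_of_ends[OF canonicalD(1)[OF P]] and q = predecomposition_of_ends[OF Q]
  note DP = diagram_overD[OF p(4)] and DQ = diagram_overD[OF q(4)]
  obtain \<phi> where \<phi>: "diagram_map Q P \<phi>" "\<phi> ord_zero = Id C (Dom C f)"
    using map_to_canonical[OF P Q] .
  note \<phi>D = diagram_mapD[OF \<phi>(1)]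
  \<comment> \<open>Orthogonality at \<open>d\<close> lets every stage of \<open>P\<close> be mapped to the fixed object \<open>B d\<close>.\<close>
  let ?K = "\<lparr>stage = \<lambda>_. ?B, link = \<lambda>_ _. Id C ?B, leg = \<lambda>_. leg Q d, apex = ?X\<rparr>
    :: ('i, 'o, 'm) predecomp"
  have K: "diagram_over ?X ?K" "absorbing ?K"
    using absorbing_constant[OF DQ(4)] orth unfolding d_def by auto
  have "\<exists>\<psi>. diagram_map P ?K \<psi> \<and> \<psi> ord_zero = link Q ord_zero d"
  proof (rule diagram_map_exists[OF p(5)])
    show "diagram_over (apex P) ?K" "absorbing ?K" using K p(2) by simp_all
    show "link Q ord_zero d \<in> hom C (stage P ord_zero) (stage ?K ord_zero)"
      using DQ(5)[OF ord_zero_le] p(1) q(1) by simp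
    show "leg ?K ord_zero \<cdot> link Q ord_zero d = leg P ord_zero"
      using DQ(8)[OF ord_zero_le] p(3) q(3) by simp
  qed
  then obtain \<psi> where \<psi>: "diagram_map P ?K \<psi>" "\<psi> ord_zero = link Q ord_zero d" by blast
  have \<psi>h: "\<psi> \<alpha> \<in> hom C (stage P \<alpha>) ?B" "leg Q d \<cdot> \<psi> \<alpha> = leg P \<alpha>" for \<alpha>
    using diagram_mapD(1,2)[OF \<psi>(1)] by auto
  have \<psi>n: "\<psi> \<beta> \<cdot> link P \<alpha> \<beta> = \<psi> \<alpha>" if "\<alpha> \<le> \<beta>" for \<alpha> \<beta>
    using diagram_mapD(3)[OF \<psi>(1) that] Id_Comp[OF \<psi>h(1)] by simp
  let ?\<rho> = "max d"
  let ?T = "\<lparr>stage = stage P \<circ> ?\<rho>, link = (\<lambda>\<alpha> \<beta>. link P (?\<rho> \<alpha>) (?\<rho> \<beta>)),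
    leg = leg P \<circ> ?\<rho>, apex = ?X\<rparr>"
  define \<kappa> where "\<kappa> \<alpha> = link P d (?\<rho> \<alpha>) \<cdot> (\<phi> d \<cdot> \<psi> \<alpha>)" for \<alpha>
  define \<iota> where "\<iota> \<alpha> = link P \<alpha> (?\<rho> \<alpha>)" for \<alpha>
  have \<phi>\<psi>: "\<phi> d \<cdot> \<psi> \<alpha> \<in> hom C (stage P \<alpha>) (stage P d)" for \<alpha>
    using Comp_in_hom[OF \<psi>h(1) \<phi>D(1)] .
  have dle: "d \<le> ?\<rho> \<alpha>" and ale: "\<alpha> \<le> ?\<rho> \<alpha>" for \<alpha> by auto
  have rmono: "?\<rho> \<alpha> \<le> ?\<rho> \<beta>" if "\<alpha> \<le> \<beta>" for \<alpha> \<beta> using that by (simp add: max.coboundedI2)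
  have \<kappa>: "diagram_map P ?T \<kappa>"
  proof -
    have "\<kappa> \<alpha> \<in> hom C (stage P \<alpha>) (stage P (?\<rho> \<alpha>))" for \<alpha>
      unfolding \<kappa>_def using Comp_in_hom[OF \<phi>\<psi> DP(5)[OF dle]] .
    moreover have "leg P (?\<rho> \<alpha>) \<cdot> \<kappa> \<alpha> = leg P \<alpha>" for \<alpha>
    proof -
      have "leg P (?\<rho> \<alpha>) \<cdot> \<kappa> \<alpha> = leg P d \<cdot> (\<phi> d \<cdot> \<psi> \<alpha>)"
        unfolding \<kappa>_def Comp_assoc[OF \<phi>\<psi> DP(5)[OF dle] DP(4), symmetric] DP(8)[OF dle] ..
      also have "\<dots> = leg P \<alpha>"
        unfolding Comp_assoc[OF \<psi>h(1) \<phi>D(1) DP(4), symmetric] \<phi>D(2) by (rule \<psi>h(2))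
      finally show ?thesis .
    qed
    moreover have "\<kappa> \<beta> \<cdot> link P \<alpha> \<beta> = link P (?\<rho> \<alpha>) (?\<rho> \<beta>) \<cdot> \<kappa> \<alpha>" if le: "\<alpha> \<le> \<beta>" for \<alpha> \<beta>
    proof -
      have "\<kappa> \<beta> \<cdot> link P \<alpha> \<beta> = link P d (?\<rho> \<beta>) \<cdot> (\<phi> d \<cdot> \<psi> \<alpha>)"
        unfolding \<kappa>_def Comp_assoc[OF DP(5)[OF le] \<phi>\<psi> DP(5)[OF dle]]
          Comp_assoc[OF DP(5)[OF le] \<psi>h(1) \<phi>D(1)] \<psi>n[OF le] ..
      also have "\<dots> = link P (?\<rho> \<alpha>) (?\<rho> \<beta>) \<cdot> \<kappa> \<alpha>"
        unfolding \<kappa>_def Comp_assoc[OF \<phi>\<psi> DP(5)[OF dle] DP(5)[OF rmono[OF le]], symmetric]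
          DP(7)[OF dle rmono[OF le]] ..
      finally show ?thesis .
    qed
    ultimately show ?thesis unfolding diagram_map_def by simp
  qed
  have \<iota>: "diagram_map P ?T \<iota>"
  proof -
    have "\<iota> \<beta> \<cdot> link P \<alpha> \<beta> = link P (?\<rho> \<alpha>) (?\<rho> \<beta>) \<cdot> \<iota> \<alpha>" if le: "\<alpha> \<le> \<beta>" for \<alpha> \<beta>
      unfolding \<iota>_def using DP(7)[OF le ale] DP(7)[OF ale rmono[OF le]] by simp
    then show ?thesis
      unfolding diagram_map_def using DP(5,8)[OF ale] by (simp add: \<iota>_def)
  qed
  have agree: "\<kappa> \<gamma> = \<iota> \<gamma>" for \<gamma>
  proof (rule diagram_maps_agree[OF p(5) \<kappa> \<iota>])
    have "\<phi> d \<cdot> \<psi> ord_zero = link P ord_zero d \<cdot> Id C (Dom C f)"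
      using \<phi>D(3)[OF ord_zero_le] \<phi>(2) \<psi>(2) by simp
    also have "\<dots> = link P ord_zero d"
      using Comp_Id[OF DP(5)[OF ord_zero_le]] p(1) by simp
    finally show "\<kappa> ord_zero = \<iota> ord_zero"
      unfolding \<kappa>_def \<iota>_def using DP(7)[OF ord_zero_le dle] by simp
  next
    fix \<alpha> assume IH: "\<kappa> \<alpha> = \<iota> \<alpha>"
    let ?s = "ord_suc \<alpha>"
    \<comment> \<open>\<open>\<mu>\<close> is the predecessor of \<open>max d (\<alpha> + 1)\<close>; the link out of \<open>A \<alpha>\<close> passes through \<open>A \<mu>\<close>.\<close>
    define \<mu> where "\<mu> = max \<epsilon> \<alpha>"
    have s\<mu>: "?\<rho> ?s = ord_suc \<mu>"
      unfolding d_def \<mu>_def by (simp add: max_def ord_suc_le_iff)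
    have le: "\<alpha> \<le> ?s" and \<mu>le: "\<mu> \<le> ord_suc \<mu>"
      using less_ord_suc by (simp_all add: less_imp_le)
    have a\<mu>: "\<alpha> \<le> \<mu>" unfolding \<mu>_def by simp
    have orth: "orth_along C (link P \<alpha> ?s) (link P \<mu> (ord_suc \<mu>)) (leg P (ord_suc \<mu>))"
      using canonicalD(3)[OF P] predecomposition_step[OF p(5)]
      unfolding absorbing_def class_orth_along_def by blast
    have hom: "\<kappa> ?s \<in> hom C (stage P ?s) (stage P (ord_suc \<mu>))"
      "\<iota> ?s \<in> hom C (stage P ?s) (stage P (ord_suc \<mu>))"
      using diagram_mapD(1)[OF \<kappa>, of ?s] diagram_mapD(1)[OF \<iota>, of ?s] s\<mu> by auto
    have \<iota>s: "\<iota> ?s \<cdot> link P \<alpha> ?s = link P \<mu> (ord_suc \<mu>) \<cdot> link P \<alpha> \<mu>"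
      unfolding \<iota>_def using DP(7)[OF le ale] DP(7)[OF a\<mu> \<mu>le] s\<mu> by simp
    show "\<kappa> ?s = \<iota> ?s"
    proof (rule filler_unique[OF orth DP(5)[OF le] DP(5)[OF \<mu>le] DP(4) DP(5)[OF a\<mu>] hom])
      show "\<kappa> ?s \<cdot> link P \<alpha> ?s = link P \<mu> (ord_suc \<mu>) \<cdot> link P \<alpha> \<mu>"
        using diagram_mapD(3)[OF \<kappa> le] diagram_mapD(3)[OF \<iota> le] IH \<iota>s by simp
      show "\<iota> ?s \<cdot> link P \<alpha> ?s = link P \<mu> (ord_suc \<mu>) \<cdot> link P \<alpha> \<mu>" by (rule \<iota>s)
      show "leg P (ord_suc \<mu>) \<cdot> \<kappa> ?s = leg P (ord_suc \<mu>) \<cdot> \<iota> ?s"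
        using diagram_mapD(2)[OF \<kappa>, of ?s] diagram_mapD(2)[OF \<iota>, of ?s] s\<mu> by simp
    qed
  qed
  show ?thesis
    unfolding stabilizes_at_def d_def[symmetric]
  proof (intro allI impI)
    fix \<beta> assume le: "d \<le> \<beta>"
    then have [simp]: "?\<rho> \<beta> = \<beta>" by simp
    have i: "link P d \<beta> \<cdot> \<phi> d \<in> hom C ?B (stage P \<beta>)"
      using Comp_in_hom[OF \<phi>D(1) DP(5)[OF le]] .
    have leg: "leg P \<beta> \<cdot> (link P d \<beta> \<cdot> \<phi> d) = leg Q d"
      using Comp_assoc[OF \<phi>D(1) DP(5)[OF le] DP(4)] DP(8)[OF le] \<phi>D(2) by simp
    have "link P d \<beta> \<cdot> \<phi> d \<cdot> \<psi> \<beta> = Id C (stage P \<beta>)"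
      using agree[of \<beta>] Comp_assoc[OF \<psi>h(1) \<phi>D(1) DP(5)[OF le]] DP(6)
      unfolding \<kappa>_def \<iota>_def by simp
    then show "class_orth C E (leg P \<beta>)"
      by (rule class_orth_retract[OF orth[folded d_def] DQ(4) DP(4) i leg \<psi>h(1)])
  qed
qed

end

section \<open>Comparison of the decomposition numbers\<close>

lemma decomp_length_stabilizes:
  "stabilizes C E P \<Longrightarrow> stabilizes_at C E P (decomp_length C E P)"
  unfolding stabilizes_def decomp_length_def by (rule LeastI_ex)

lemma decomp_length_le: "stabilizes_at C E P \<alpha> \<Longrightarrow> decomp_length C E P \<le> \<alpha>"
  unfolding decomp_length_def by (rule Least_le)

theorem theorem2p39:
  fixes C :: "('o, 'm) cat" and E :: "'m set" and f :: 'm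
  assumes "universe_ordinal TYPE('i::wellorder)"
    and "category C"
    and "E \<subseteq> Arr C"
    and "f \<in> Arr C"
    and "\<exists>P :: ('i, 'o, 'm) predecomp. canonical_predecomposition_of C E f P"
  shows "let \<delta> = (min_decomp_number C E f :: 'i option);
             \<sigma> = (canonical_decomp_number C E f :: 'i option)
         in (\<delta> \<noteq> None \<longleftrightarrow> \<sigma> \<noteq> None) \<and>
            (\<forall>d s. \<delta> = Some d \<and> \<sigma> = Some s \<longrightarrow> d \<le> s \<and> s \<le> ord_suc d) \<and>
            (\<forall>d. \<delta> = Some d \<and> is_successor d \<longrightarrow> \<sigma> = Some d)"
proof -
  interpret category C by fact
  interpret unbounded_category C E "TYPE('i)"
    using assms(3) universe_ordinal_no_greatest[OF assms(1)] by unfold_locales auto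
  obtain P :: "('i, 'o, 'm) predecomp" where P: "canonical_predecomposition_of C E f P"
    using assms(5) by blast
  have \<sigma>: "canonical_decomp_number C E f =
      (if stabilizes C E P then Some (decomp_length C E P) else None)"
  proof -
    have same: "stabilizes C E P' = stabilizes C E P" "decomp_length C E P' = decomp_length C E P"
      if "canonical_predecomposition_of C E f P'" for P' :: "('i, 'o, 'm) predecomp"
      using canonical_stabilizes_at_unique[OF that P]
      unfolding stabilizes_def decomp_length_def by simp_all
    have "(THE \<alpha>. \<exists>P' :: ('i, 'o, 'm) predecomp. canonical_predecomposition_of C E f P' \<and>
        stabilizes C E P' \<and> decomp_length C E P' = \<alpha>) = decomp_length C E P" if "stabilizes C E P"
    proof (rule the_equality)
      show "\<exists>P' :: ('i, 'o, 'm) predecomp. canonical_predecomposition_of C E f P' \<and>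
          stabilizes C E P' \<and> decomp_length C E P' = decomp_length C E P"
        using P that by blast
    qed (use same(2) in blast)
    moreover have "(\<exists>P' :: ('i, 'o, 'm) predecomp. canonical_predecomposition_of C E f P' \<and>
        stabilizes C E P') \<longleftrightarrow> stabilizes C E P"
      using P same(1) by blast
    ultimately show ?thesis unfolding canonical_decomp_number_def by simp
  qed
  show ?thesis
  proof (cases "\<exists>Q :: ('i, 'o, 'm) predecomp. decomposition_of C E f Q")
    case False
    then have "\<not> stabilizes C E P" using canonicalD(1)[OF P] unfolding decomposition_of_def by blast
    then show ?thesis using False \<sigma> unfolding min_decomp_number_def by simp
  next
    case True
    define d where "d = (LEAST \<alpha>. \<exists>Q :: ('i, 'o, 'm) predecomp.
       decomposition_of C E f Q \<and> decomp_length C E Q = \<alpha>)"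
    have \<delta>: "min_decomp_number C E f = Some d" unfolding min_decomp_number_def d_def using True by simp
    have "\<exists>Q :: ('i, 'o, 'm) predecomp. decomposition_of C E f Q \<and> decomp_length C E Q = d"
      unfolding d_def
    proof (rule LeastI_ex)
      show "\<exists>\<alpha>. \<exists>Q :: ('i, 'o, 'm) predecomp. decomposition_of C E f Q \<and> decomp_length C E Q = \<alpha>"
        using True by simp
    qed
    then obtain Q :: "('i, 'o, 'm) predecomp"
      where decomp: "decomposition_of C E f Q" and len: "decomp_length C E Q = d" by (elim exE conjE)
    have Q: "predecomposition_of C E f Q" and at: "stabilizes_at C E Q d"
      using decomp decomp_length_stabilizes[of C E Q] len unfolding decomposition_of_def by simp_all
    have orth: "class_orth C E (leg Q \<beta>)" if "d \<le> \<beta>" for \<beta>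
      using at that unfolding stabilizes_at_def by blast
    \<comment> \<open>The length \<open>d\<close> may be a limit, but \<open>Q\<close> is still orthogonal at the successor \<open>d + 1\<close>.\<close>
    have suc: "stabilizes_at C E P (ord_suc d)"
      by (intro canonical_stabilizes_at_successor[OF P Q] orth less_imp_le less_ord_suc)
    then have stab: "stabilizes C E P" unfolding stabilizes_def by blast
    have lower: "d \<le> decomp_length C E P"
      unfolding d_def
    proof (rule Least_le, intro exI conjI)
      show "decomposition_of C E f P"
        using stab canonicalD(1)[OF P] unfolding decomposition_of_def by (rule conjI[rotated])
    qed (rule refl)
    have "decomp_length C E P \<le> d" if succ: "is_successor d"
    proof -
      obtain \<epsilon> where \<epsilon>: "d = ord_suc \<epsilon>" using succ unfolding is_successor_def by blast
      show ?thesis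
        using canonical_stabilizes_at_successor[OF P Q orth] \<epsilon> by (intro decomp_length_le) simp
    qed
    then show ?thesis
      using \<delta> \<sigma> stab lower decomp_length_le[OF suc] by (auto simp: Let_def)
  qed
qed

end
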